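(* Let $P$ be a linear program which is either a maximisation LP of the form $\max\{c^\top x : Ax \le b,\ x \ge 0\}$ with $c \in \mathbb{R}^n$, $b \in \mathbb{R}^m$, $A \in \mathbb{R}^{m\times n}$, or a minimisation LP of the form $\min\{v^\top x : Mx \ge u,\ x \ge 0\}$ with $v \in \mathbb{R}^n$, $u \in \mathbb{R}^m$, $M \in \mathbb{R}^{m \times n}$. Let $\overline{P}$ denote its complement (defined below). Then $\mathrm{Opt}(P) > 1$ if and only if $\mathrm{Opt}(\overline{P}) > 1$, in which case \[ \frac{1}{\mathrm{Opt}(P)} + \frac{1}{\mathrm{Opt}(\overline{P})} = 1. \]
   Context: For an LP $R$, $\mathrm{Opt}(R)$ denotes its optimal value (when it exists, i.e. when $R$ is feasible and bounded). The complement of the maximisation LP $P=\max\{c^\top x : Ax \le b,\ x\ge 0\}$ is the minimisation LP $\overline{P} = \min\{c^\top x : (b c^\top - A)x \ge b,\ x \ge 0\}$. The complement of the minimisation LP $Q = \min\{v^\top x : Mx \ge u,\ x \ge 0\}$ is the maximisation LP $\overline{Q} = \max\{v^\top x : (u v^\top - M)x \le u,\ x \ge 0\}$. *)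

theory Defs
  imports "HOL-Analysis.Analysis"
begin

text \<open>
  Linear programs over the reals with \<open>CARD('n)\<close> variables and \<open>CARD('m)\<close> constraints.
  \<open>MaxLP A b c\<close> is $\max\{c^T x : Ax \le b, x \ge 0\}$ and
  \<open>MinLP M u v\<close> is $\min\{v^T x : Mx \ge u, x \ge 0\}$.
  The order on vectors is the componentwise one.
\<close>

datatype ('m::finite, 'n::finite) lp =
    MaxLP "real^'n^'m" "real^'m" "real^'n"
  | MinLP "real^'n^'m" "real^'m" "real^'n"

fun feasible_set :: "('m::finite, 'n::finite) lp \<Rightarrow> (real^'n) set" where
  "feasible_set (MaxLP A b c) = {x. A *v x \<le> b \<and> x \<ge> 0}"
| "feasible_set (MinLP M u v) = {x. M *v x \<ge> u \<and> x \<ge> 0}"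

fun objective :: "('m::finite, 'n::finite) lp \<Rightarrow> real^'n \<Rightarrow> real" where
  "objective (MaxLP A b c) x = c \<bullet> x"
| "objective (MinLP M u v) x = v \<bullet> x"

definition feasible :: "('m::finite, 'n::finite) lp \<Rightarrow> bool" where
  "feasible R \<longleftrightarrow> feasible_set R \<noteq> {}"

text \<open>Boundedness concerns only the direction of optimisation.\<close>

fun bounded_lp :: "('m::finite, 'n::finite) lp \<Rightarrow> bool" where
  "bounded_lp (MaxLP A b c) \<longleftrightarrow>
     bdd_above (objective (MaxLP A b c) ` feasible_set (MaxLP A b c))"
| "bounded_lp (MinLP M u v) \<longleftrightarrow>
     bdd_below (objective (MinLP M u v) ` feasible_set (MinLP M u v))"

definition has_opt :: "('m::finite, 'n::finite) lp \<Rightarrow> bool" where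
  "has_opt R \<longleftrightarrow> feasible R \<and> bounded_lp R"

text \<open>The value of \<open>Opt R\<close> is meaningful only if \<open>has_opt R\<close> holds.\<close>

fun Opt :: "('m::finite, 'n::finite) lp \<Rightarrow> real" where
  "Opt (MaxLP A b c) = (SUP x \<in> feasible_set (MaxLP A b c). objective (MaxLP A b c) x)"
| "Opt (MinLP M u v) = (INF x \<in> feasible_set (MinLP M u v). objective (MinLP M u v) x)"

text \<open>The rank-one matrix $b c^T$.\<close>

definition outer_product :: "real^'m \<Rightarrow> real^'n \<Rightarrow> real^'n^'m" where
  "outer_product b c = (\<chi> i j. b $ i * c $ j)"

fun complement :: "('m::finite, 'n::finite) lp \<Rightarrow> ('m, 'n) lp" where
  "complement (MaxLP A b c) = MinLP (outer_product b c - A) b c"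
| "complement (MinLP M u v) = MaxLP (outer_product u v - M) u v"

end

theory Submission imports Defs
begin

text \<open>
  Since $bc^T x = (c^T x)b$, the constraint of the complement of $\max\{c^T x : Ax \le b, x \ge 0\}$
  reads $Ax \le (c^T x - 1)b$. Hence $y \mapsto y/(c^T y - 1)$ is a bijection between the feasible
  points of value greater than $1$ of the two programs, and it acts on values by the decreasing
  involution $t \mapsto t/(t-1)$ of $(1,\infty)$. It remains to exclude feasible points of the
  minimisation program of value at most $1$ when the maximisation program is bounded and has a point
  of value greater than $1$: each would yield a recession direction along which the latter is
  unbounded.
\<close>

lemma hyperbola_gt_1: "t / (t - 1) > 1" if "t > 1" for t :: real
  using that by (simp add: field_simps)

text \<open>Clearing the positive denominators turns both sides into
  \<open>(s - 1) * (t - 1) \<ge> 1\<close>, which is symmetric in \<open>s\<close> and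
  \<open>t\<close>.\<close>

lemma hyperbola_le_iff: "s / (s - 1) \<le> t \<longleftrightarrow> t / (t - 1) \<le> s" if "s > 1" "t > 1" for s t :: real
  using that by (simp add: field_simps)

lemma le_hyperbola_iff: "s \<le> t / (t - 1) \<longleftrightarrow> t \<le> s / (s - 1)" if "s > 1" "t > 1" for s t :: real
  using that by (auto simp: field_simps)

lemma scaleR_right_mono_vec: "a *\<^sub>R x \<le> a *\<^sub>R y" if "0 \<le> a" "x \<le> y" for x y :: "real^'k"
  using that by (simp add: less_eq_vec_def mult_left_mono)

lemma outer_product_vector_mult: "outer_product b c *v x = (c \<bullet> x) *\<^sub>R b"
  by (simp add: vec_eq_iff outer_product_def matrix_vector_mult_def inner_vec_def
      sum_distrib_left mult_ac)

lemma complement_complement: "complement (complement P) = P"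
  by (cases P) auto

lemma objective_complement: "objective (complement P) = objective P"
  by (cases P) auto

lemma objective_scaleR: "objective P (a *\<^sub>R x) = a * objective P x"
  by (cases P) auto

text \<open>With \<open>a = 1 / (objective P y - 1)\<close> the scaled point has value
  \<open>1 + a\<close>, so the constraint of the complement at that point is the original constraint
  at \<open>y\<close> multiplied by \<open>a\<close>. Applied to \<open>complement P\<close>, the
  lemma yields the inverse map.\<close>

lemma feasible_set_complement:
  assumes "y \<in> feasible_set P" "objective P y > 1"
  shows "(1 / (objective P y - 1)) *\<^sub>R y \<in> feasible_set (complement P)"
proof -
  define a where "a = 1 / (objective P y - 1)"
  have a: "a \<ge> 0" "a * objective P y - 1 = a"
    using assms(2) by (auto simp: a_def field_simps)
  have y: "0 \<le> y"
    using assms(1) by (cases P) auto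
  have nonneg: "0 \<le> a *\<^sub>R y"
    using scaleR_right_mono_vec[OF a(1) y] by simp
  have "a *\<^sub>R y \<in> feasible_set (complement P)"
  proof (cases P)
    case (MaxLP A b c)
    have "A *v (a *\<^sub>R y) \<le> (c \<bullet> (a *\<^sub>R y) - 1) *\<^sub>R b"
      using a assms(1) scaleR_right_mono_vec[of a "A *v y" b]
      by (simp add: MaxLP matrix_vector_mult_scaleR)
    then show ?thesis
      using nonneg by (simp add: MaxLP matrix_vector_mult_diff_rdistrib
          outer_product_vector_mult algebra_simps)
  next
    case (MinLP M u v)
    have "(v \<bullet> (a *\<^sub>R y) - 1) *\<^sub>R u \<le> M *v (a *\<^sub>R y)"
      using a assms(1) scaleR_right_mono_vec[of a u "M *v y"]
      by (simp add: MinLP matrix_vector_mult_scaleR)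
    then show ?thesis
      using nonneg by (simp add: MinLP matrix_vector_mult_diff_rdistrib
          outer_product_vector_mult algebra_simps)
  qed
  then show ?thesis by (simp add: a_def)
qed

lemma complement_value:
  assumes "y \<in> feasible_set P" "objective P y = t" "t > 1"
  obtains x where "x \<in> feasible_set (complement P)" "objective (complement P) x = t / (t - 1)"
  using feasible_set_complement[of y P] assms
  by (auto simp: objective_complement objective_scaleR)

lemma recession_direction_unbounded:
  assumes "y \<in> feasible_set (MaxLP A b c)" "A *v d \<le> 0" "0 \<le> d" "0 < c \<bullet> d"
  shows "\<not> bounded_lp (MaxLP A b c)"
proof
  assume "bounded_lp (MaxLP A b c)"
  then obtain B where B: "\<And>x. x \<in> feasible_set (MaxLP A b c) \<Longrightarrow> c \<bullet> x \<le> B"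
    by (auto simp: bdd_above_def)
  \<comment> \<open>A step of this length from \<open>y\<close> raises the objective to \<open>c
    \<bullet> y + \<bar>B\<bar> + \<bar>c \<bullet> y\<bar> + 1\<close>, which exceeds
    \<open>B\<close>.\<close>
  define k where "k = (\<bar>B\<bar> + \<bar>c \<bullet> y\<bar> + 1) / (c \<bullet> d)"
  have k: "k \<ge> 0" "k * (c \<bullet> d) = \<bar>B\<bar> + \<bar>c \<bullet> y\<bar> + 1"
    using assms(4) by (auto simp: k_def)
  have "k *\<^sub>R (A *v d) \<le> 0" "0 \<le> k *\<^sub>R d"
    using scaleR_right_mono_vec[OF k(1)] assms(2,3) by fastforce+
  then have "y + k *\<^sub>R d \<in> feasible_set (MaxLP A b c)"
    using assms(1) add_mono[of "A *v y" b "k *\<^sub>R (A *v d)" 0]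
    by (simp add: matrix_vector_right_distrib matrix_vector_mult_scaleR)
  from B[OF this] k(2) show False
    by (simp add: inner_add_right)
qed

lemma complement_objective_gt_1:
  assumes bdd: "bounded_lp (MaxLP A b c)"
    and y: "y \<in> feasible_set (MaxLP A b c)" "c \<bullet> y > 1"
    and x: "x \<in> feasible_set (complement (MaxLP A b c))"
  shows "c \<bullet> x > 1"
proof (rule ccontr)
  assume "\<not> c \<bullet> x > 1"
  then have le: "c \<bullet> x \<le> 1" by simp
  \<comment> \<open>The constraint at \<open>x\<close> is
    \<open>A *v x \<le> - (1 - c \<bullet> x) *\<^sub>R b\<close>. Weighting \<open>y\<close> by
    \<open>1 - c \<bullet> x\<close> makes the multiples of \<open>b\<close> cancel, so
    \<open>d\<close> is a recession direction.\<close>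
  define d where "d = (1 - c \<bullet> x) *\<^sub>R y + x"
  have Ax: "A *v x \<le> (c \<bullet> x - 1) *\<^sub>R b" and x0: "0 \<le> x"
    using x by (auto simp: matrix_vector_mult_diff_rdistrib outer_product_vector_mult algebra_simps)
  have Ay: "(1 - c \<bullet> x) *\<^sub>R (A *v y) \<le> (1 - c \<bullet> x) *\<^sub>R b" and "0 \<le> (1 - c \<bullet> x) *\<^sub>R y"
    using scaleR_right_mono_vec[of "1 - c \<bullet> x"] le y(1) by fastforce+
  then have "0 \<le> d"
    using x0 by (simp add: d_def)
  moreover have "A *v d \<le> 0"
    using add_mono[OF Ay Ax]
    by (simp add: d_def matrix_vector_right_distrib matrix_vector_mult_scaleR algebra_simps)
  \<comment> \<open>Since \<open>c \<bullet> y > 1\<close>, the value of \<open>d\<close> is at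
    least \<open>(1 - c \<bullet> x) + c \<bullet> x = 1\<close>.\<close>
  moreover have "0 < c \<bullet> d"
  proof -
    have "1 - c \<bullet> x \<le> (1 - c \<bullet> x) * (c \<bullet> y)"
      using mult_left_mono[of 1 "c \<bullet> y" "1 - c \<bullet> x"] le y(2) by simp
    moreover have "1 - c \<bullet> x < (1 - c \<bullet> x) * (c \<bullet> y)" if "c \<bullet> x < 1"
      using mult_strict_left_mono[OF y(2), of "1 - c \<bullet> x"] that by simp
    moreover have "c \<bullet> d = (1 - c \<bullet> x) * (c \<bullet> y) + c \<bullet> x"
      by (simp add: d_def inner_add_right)
    ultimately show ?thesis using le by argo
  qed
  ultimately show False
    using recession_direction_unbounded[OF y(1)] bdd by blast
qed

text \<open>Every value of the complement exceeds 1, so the decreasing involution carries the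
  supremum of the values of \<open>P\<close> to the infimum of those of the complement.\<close>

lemma has_opt_complement_MaxLP:
  fixes A :: "real^'n^'m" and b c
  defines "P \<equiv> MaxLP A b c"
  assumes opt: "has_opt P" and gt: "Opt P > 1"
  shows "has_opt (complement P)" "Opt (complement P) = Opt P / (Opt P - 1)"
proof -
  let ?s = "Opt P"
  let ?V = "objective P ` feasible_set P" and ?W = "objective P ` feasible_set (complement P)"
  have V: "?V \<noteq> {}" "bdd_above ?V" "Opt P = Sup ?V"
    using opt by (auto simp: P_def has_opt_def feasible_def)
  have W: "Opt (complement P) = Inf ?W" "bounded_lp (complement P) \<longleftrightarrow> bdd_below ?W"
    by (auto simp: P_def)
  \<comment> \<open>Points with values close to the supremum stand in for an optimal point, so
    attainment is never invoked.\<close>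
  have approx: "\<exists>y\<in>feasible_set P. r < objective P y" if "r < ?s" for r
    using that less_cSup_iff[OF V(1,2)] V(3) by auto
  obtain y where y: "y \<in> feasible_set P" "objective P y > 1"
    using approx[OF gt] by auto
  have lower: "?s / (?s - 1) \<le> w" if "w \<in> ?W" for w
  proof -
    from that obtain x where x: "x \<in> feasible_set (complement P)" "w = objective P x" by auto
    then have w: "w > 1"
      using complement_objective_gt_1[of A b c y x] opt y by (simp add: P_def has_opt_def)
    \<comment> \<open>The correspondence is run backwards, from the complement to
      \<open>P\<close>.\<close>
    obtain z where "z \<in> feasible_set P" "objective P z = w / (w - 1)"
      using complement_value[of x "complement P" w] x w
      by (auto simp: complement_complement objective_complement)
    then have "w / (w - 1) \<le> ?s"
      using V(2,3) by (metis cSup_upper image_eqI)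
    then show ?thesis
      using hyperbola_le_iff w gt by blast
  qed
  \<comment> \<open>A larger lower bound \<open>l\<close> would have its image
    \<open>l / (l - 1)\<close> below \<open>?s\<close>. A point of \<open>P\<close> with value
    beyond that image is sent to a point of the complement with value below
    \<open>l\<close>.\<close>
  have greatest: "l \<le> ?s / (?s - 1)" if l: "\<And>w. w \<in> ?W \<Longrightarrow> l \<le> w" for l
  proof (rule ccontr)
    assume *: "\<not> ?thesis"
    then have l1: "l > 1"
      using hyperbola_gt_1[OF gt] by linarith
    with * have "l / (l - 1) < ?s"
      using le_hyperbola_iff[of l ?s] gt by linarith
    then obtain z where z: "z \<in> feasible_set P" "l / (l - 1) < objective P z"
      using approx by blast
    then have z1: "objective P z > 1"
      using hyperbola_gt_1[OF l1] by linarith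
    then obtain x where "x \<in> feasible_set (complement P)"
      "objective P x = objective P z / (objective P z - 1)"
      using complement_value[OF z(1) refl] by (auto simp: objective_complement)
    then have "l \<le> objective P z / (objective P z - 1)"
      using l by (metis image_eqI)
    then show False
      using z(2) le_hyperbola_iff[OF l1 z1] by auto
  qed
  have ne: "?W \<noteq> {}"
    using feasible_set_complement[OF y] by auto
  show "has_opt (complement P)"
    using ne W(2) bdd_belowI[of ?W, OF lower] by (auto simp: has_opt_def feasible_def)
  show "Opt (complement P) = ?s / (?s - 1)"
    unfolding W(1) using lower greatest by (intro cInf_eq_non_empty ne) auto
qed

text \<open>All values of the complement are at least its infimum, hence exceed 1. Their images
  bound the values of \<open>P\<close>, and any feasible point of the complement is carried to a
  point of \<open>P\<close> of value above 1.\<close>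

lemma has_opt_of_complement_MaxLP:
  fixes A :: "real^'n^'m" and b c
  defines "P \<equiv> MaxLP A b c"
  assumes opt: "has_opt (complement P)" and gt: "Opt (complement P) > 1"
  shows "has_opt P" "Opt P > 1"
proof -
  let ?q = "Opt (complement P)"
  let ?V = "objective P ` feasible_set P" and ?W = "objective P ` feasible_set (complement P)"
  have W: "?W \<noteq> {}" "bdd_below ?W" "?q = Inf ?W"
    using opt by (auto simp: P_def has_opt_def feasible_def)
  have lower: "?q \<le> objective P x" if "x \<in> feasible_set (complement P)" for x
    using that W(2,3) by (simp add: cINF_lower)
  have upper: "t \<le> ?q / (?q - 1)" if "t \<in> ?V" for t
  proof (cases "t > 1")
    case True
    from that obtain y where y: "y \<in> feasible_set P" "objective P y = t" by auto
    obtain x where x: "x \<in> feasible_set (complement P)" "objective P x = t / (t - 1)"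
      using complement_value[OF y True] by (auto simp: objective_complement)
    then show ?thesis
      using lower[OF x(1)] le_hyperbola_iff[OF gt True] by simp
  next
    \<comment> \<open>Values up to 1 lie below the bound because the bound itself exceeds 1.\<close>
    case False
    then show ?thesis using hyperbola_gt_1[OF gt] by linarith
  qed
  then have bdd: "bdd_above ?V" by (rule bdd_aboveI)
  obtain x where x: "x \<in> feasible_set (complement P)"
    using W(1) by auto
  then have x1: "objective P x > 1"
    using lower gt by fastforce
  then obtain y where y: "y \<in> feasible_set P"
    "objective P y = objective P x / (objective P x - 1)"
    using complement_value[OF x] by (auto simp: complement_complement objective_complement)
  show "has_opt P"
    using bdd y(1) by (auto simp: P_def has_opt_def feasible_def)
  have "objective P y \<le> Sup ?V"
    using bdd y(1) by (simp add: cSUP_upper)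
  then show "Opt P > 1"
    using hyperbola_gt_1[OF x1] y(2) by (simp add: P_def)
qed

lemma complement_MaxLP:
  fixes A :: "real^'n^'m" and b c
  defines "P \<equiv> MaxLP A b c"
  shows "has_opt P \<and> Opt P > 1 \<longleftrightarrow> has_opt (complement P) \<and> Opt (complement P) > 1"
    and "has_opt P \<and> Opt P > 1 \<Longrightarrow> 1 / Opt P + 1 / Opt (complement P) = 1"
proof -
  note forward = has_opt_complement_MaxLP[of A b c, folded P_def]
  note backward = has_opt_of_complement_MaxLP[of A b c, folded P_def]
  show "has_opt P \<and> Opt P > 1 \<longleftrightarrow> has_opt (complement P) \<and> Opt (complement P) > 1"
    using forward backward hyperbola_gt_1[of "Opt P"] by metis
  assume P: "has_opt P \<and> Opt P > 1"
  then have "Opt (complement P) = Opt P / (Opt P - 1)"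
    using forward by blast
  \<comment> \<open>The reciprocal of \<open>Opt P / (Opt P - 1)\<close> is
    \<open>1 - 1 / Opt P\<close>.\<close>
  with P show "1 / Opt P + 1 / Opt (complement P) = 1"
    by (simp add: diff_divide_distrib)
qed

theorem theorem1:
  fixes P :: "('m::finite, 'n::finite) lp"
  shows "(has_opt P \<and> Opt P > 1 \<longleftrightarrow> has_opt (complement P) \<and> Opt (complement P) > 1) \<and>
         (has_opt P \<and> Opt P > 1 \<longrightarrow> 1 / Opt P + 1 / Opt (complement P) = 1)"
proof (cases P)
  case (MaxLP A b c)
  then show ?thesis using complement_MaxLP[of A b c] by blast
\<comment> \<open>The claim is symmetric in a program and its complement, so the minimisation case
  is the maximisation case for \<open>complement P\<close>.\<close>
next
  case (MinLP M u v)
  then obtain A b c where Q: "complement P = MaxLP A b c" by simp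
  then have "complement (MaxLP A b c) = P"
    using complement_complement[of P] by simp
  then show ?thesis
    using complement_MaxLP[of A b c] Q by (simp add: add.commute)
qed

end
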